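(* Let $N\ge 1$. For $\varepsilon\in\{1,-1\}$ and $k\ge 0$ put $\alpha_N^{(k)}=Q_N\sigma_{2N}(1)^kQ_N^\top$ and $\beta_N^{(k)}=Q_N\sigma_{2N}(-1)^kQ_N^\top$, and let $\alpha_N=\alpha_N^{(1)}$, $\beta_N=\beta_N^{(1)}$. Let $\gamma^{(0)}=2I$ (infinite identity) and for $k\ge 1$ let $\gamma^{(k)}$ be the infinite matrix with rows and columns indexed by $\mathbb{Z}_{\ge 0}$ whose $(i,j)$ entry is $1$ if $|i-j|=k$ or $i+j=k-1$ and $0$ otherwise; put $\gamma=\gamma^{(1)}$. Let $\delta$ be any one of $\alpha_N$, $\beta_N$, $\gamma$. Then $\delta^{(1)}=\delta$, $\delta^{(0)}=2I$, and for every $k\ge 2$, $$\delta^{(k)}=\delta\cdot\delta^{(k-1)}-\delta^{(k-2)}.$$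
   Context: $J_N$ is the $N\times N$ exchange matrix (ones on the antidiagonal, zeros elsewhere), $I_N$ the identity, and $Q_N=\begin{pmatrix}J_N & I_N\end{pmatrix}$ is the $N\times 2N$ block matrix. For a scalar $\varepsilon$, $\sigma_{2N}(\varepsilon)$ is the $2N\times 2N$ matrix (indices $0,\dots,2N-1$) with $(i,j)$ entry $1$ if $i=j+1$, $\varepsilon$ if $(i,j)=(0,2N-1)$, and $0$ otherwise. Products of the infinite matrices $\gamma^{(k)}$ are well-defined since every row and column has finitely many nonzero entries. *)

theory Defs
  imports "Jordan_Normal_Form.Matrix" "HOL-Library.Groups_Big_Fun"
begin

definition exchange_mat :: "nat \<Rightarrow> 'a::{zero,one} mat" where
  "exchange_mat N = mat N N (\<lambda>(i, j). if i + j = N - 1 then 1 else 0)"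

text \<open>The block row (J I), written as a four-block matrix whose lower blocks have no rows.\<close>

definition Q_mat :: "nat \<Rightarrow> 'a::{zero,one} mat" where
  "Q_mat N = four_block_mat (exchange_mat N) (1\<^sub>m N) (0\<^sub>m 0 N) (0\<^sub>m 0 N)"

definition sigma_mat :: "nat \<Rightarrow> 'a::{zero,one} \<Rightarrow> 'a mat" where
  "sigma_mat n \<epsilon> = mat n n (\<lambda>(i, j).
     if i = j + 1 then 1 else if (i, j) = (0, n - 1) then \<epsilon> else 0)"

definition alpha_seq :: "nat \<Rightarrow> nat \<Rightarrow> 'a::comm_ring_1 mat" where
  "alpha_seq N k = Q_mat N * (sigma_mat (2 * N) 1 ^\<^sub>m k) * transpose_mat (Q_mat N)"

definition beta_seq :: "nat \<Rightarrow> nat \<Rightarrow> 'a::comm_ring_1 mat" where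
  "beta_seq N k = Q_mat N * (sigma_mat (2 * N) (-1) ^\<^sub>m k) * transpose_mat (Q_mat N)"

definition alpha :: "nat \<Rightarrow> 'a::comm_ring_1 mat" where
  "alpha N = alpha_seq N 1"

definition beta :: "nat \<Rightarrow> 'a::comm_ring_1 mat" where
  "beta N = beta_seq N 1"

text \<open>Infinite matrices are functions of a row and a column index; subtraction is the
  pointwise subtraction of functions. The sum \<^const>\<open>Sum_any\<close> ranges over the nonzero
  summands, so it is the matrix product whenever each of these sums has finite support, as it
  does when all rows and columns of the factors have finite support.\<close>

type_synonym 'a inf_mat = "nat \<Rightarrow> nat \<Rightarrow> 'a"

definition inf_one :: "'a::{zero,one} inf_mat" where
  "inf_one = (\<lambda>i j. if i = j then 1 else 0)"

definition inf_smult :: "'a::times \<Rightarrow> 'a inf_mat \<Rightarrow> 'a inf_mat" where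
  "inf_smult c A = (\<lambda>i j. c * A i j)"

definition inf_times :: "'a::semiring_0 inf_mat \<Rightarrow> 'a inf_mat \<Rightarrow> 'a inf_mat" where
  "inf_times A B = (\<lambda>i j. Sum_any (\<lambda>l. A i l * B l j))"

definition gamma_seq :: "nat \<Rightarrow> 'a::comm_ring_1 inf_mat" where
  "gamma_seq k = (if k = 0 then inf_smult 2 inf_one
     else (\<lambda>i j. if \<bar>int i - int j\<bar> = int k \<or> i + j = k - 1 then 1 else 0))"

definition gamma :: "'a::comm_ring_1 inf_mat" where
  "gamma = gamma_seq 1"

lemma finite_gamma_seq_row: "finite {j. (gamma_seq k i j :: 'a::comm_ring_1) \<noteq> 0}"
  by (rule finite_subset[of _ "{..i + k}"])
    (auto simp: gamma_seq_def inf_smult_def inf_one_def split: if_splits)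

lemma finite_gamma_seq_col: "finite {i. (gamma_seq k i j :: 'a::comm_ring_1) \<noteq> 0}"
  by (rule finite_subset[of _ "{..j + k}"])
    (auto simp: gamma_seq_def inf_smult_def inf_one_def split: if_splits)

end

(*
  Idea: Q^T Q = I + J, where J is the exchange matrix of order 2N, and Q J = Q.  If eps^2 = 1 then
  sigma J sigma = J, so inserting Q^T Q into Q sigma (Q^T Q) sigma^(k-1) Q^T yields
  Q sigma^k Q^T + Q sigma^(k-2) Q^T.  For gamma, multiplication by gamma from the left adds the
  two neighbouring rows, where row -1 is by reflection a copy of row 0.
*)

theory Submission
  imports Defs
begin

lemma exchange_mat_carrier [simp]: "exchange_mat n \<in> carrier_mat n n"
  by (simp add: exchange_mat_def)

lemma sigma_mat_carrier [simp]: "sigma_mat n \<epsilon> \<in> carrier_mat n n"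
  by (simp add: sigma_mat_def)

lemma Q_mat_carrier [simp]: "Q_mat N \<in> carrier_mat N (2 * N)"
  by (auto simp: Q_mat_def exchange_mat_def)

lemma index_exchange_mat_mult:
  fixes A :: "'a::semiring_1 mat"
  assumes "A \<in> carrier_mat n m" "i < n" "j < m"
  shows "(exchange_mat n * A) $$ (i, j) = A $$ (n - 1 - i, j)"
proof -
  have "(exchange_mat n * A) $$ (i, j)
      = (\<Sum>l\<in>{0..<n}. (if i + l = n - 1 then 1 else 0) * A $$ (l, j))"
    using assms by (simp add: exchange_mat_def scalar_prod_def)
  also have "\<dots> = (\<Sum>l\<in>{0..<n}. if l = n - 1 - i then A $$ (l, j) else 0)"
    by (rule sum.cong) (use assms in auto)
  finally show ?thesis
    using assms by simp
qed

text \<open>Each row of \<open>sigma_mat\<close> has a single possibly nonzero entry, so the product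
  only moves rows down by one. The last row wraps around to the top with weight
  \<open>\<epsilon>\<close>.\<close>

lemma index_sigma_mat_mult:
  fixes A :: "'a::semiring_1 mat"
  assumes "A \<in> carrier_mat n m" "i < n" "j < m"
  shows "(sigma_mat n \<epsilon> * A) $$ (i, j)
    = (if i = 0 then \<epsilon> * A $$ (n - 1, j) else A $$ (i - 1, j))"
proof -
  have "(sigma_mat n \<epsilon> * A) $$ (i, j)
      = (\<Sum>l\<in>{0..<n}. (if i = l + 1 then 1 else if (i, l) = (0, n - 1) then \<epsilon> else 0) * A $$ (l, j))"
    using assms by (simp add: sigma_mat_def scalar_prod_def)
  also have "\<dots> = (\<Sum>l\<in>{0..<n}. if l = (if i = 0 then n - 1 else i - 1)
      then (if i = 0 then \<epsilon> else 1) * A $$ (l, j) else 0)"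
    by (rule sum.cong) (use assms in auto)
  finally show ?thesis
    using assms by (auto split: if_splits)
qed

lemma exchange_mat_mult_self: "exchange_mat n * exchange_mat n = (1\<^sub>m n :: 'a::semiring_1 mat)"
proof (rule eq_matI)
  fix i j assume "i < dim_row (1\<^sub>m n :: 'a mat)" "j < dim_col (1\<^sub>m n :: 'a mat)"
  then show "(exchange_mat n * exchange_mat n) $$ (i, j) = (1\<^sub>m n :: 'a mat) $$ (i, j)"
    by (subst index_exchange_mat_mult[where m = n]) (auto simp: exchange_mat_def)
qed (auto simp: exchange_mat_def)

lemma transpose_exchange_mat: "transpose_mat (exchange_mat n) = exchange_mat n"
  by (auto simp: exchange_mat_def add.commute)

lemma exchange_mat_double:
  "exchange_mat (2 * N)
    = four_block_mat (0\<^sub>m N N) (exchange_mat N) (exchange_mat N) (0\<^sub>m N N :: 'a::semiring_1 mat)"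
  by (rule eq_matI) (auto simp: exchange_mat_def)

lemma one_plus_exchange_mat_double:
  "1\<^sub>m (2 * N) + exchange_mat (2 * N)
    = four_block_mat (1\<^sub>m N) (exchange_mat N) (exchange_mat N) (1\<^sub>m N :: 'a::semiring_1 mat)"
  by (rule eq_matI) (auto simp: exchange_mat_def)

text \<open>Reversing the order of the basis turns the shift into its inverse. The wrap-around
  enters twice on the last basis vector and never on the others, so \<open>\<epsilon>\<close>
  survives only as \<open>\<epsilon> * \<epsilon>\<close>.\<close>

lemma sigma_exchange_sigma:
  fixes \<epsilon> :: "'a::semiring_1"
  assumes "\<epsilon> * \<epsilon> = 1"
  shows "sigma_mat n \<epsilon> * (exchange_mat n * sigma_mat n \<epsilon>) = exchange_mat n"
proof (rule eq_matI)
  fix i j assume "i < dim_row (exchange_mat n :: 'a mat)" "j < dim_col (exchange_mat n :: 'a mat)"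
  then have ij: "i < n" "j < n"
    by (auto simp: exchange_mat_def)
  have "exchange_mat n * sigma_mat n \<epsilon> \<in> carrier_mat n n"
    by (rule mult_carrier_mat[where n = n]) auto
  then show "(sigma_mat n \<epsilon> * (exchange_mat n * sigma_mat n \<epsilon>)) $$ (i, j)
      = exchange_mat n $$ (i, j)"
    using ij assms
    by (simp add: index_sigma_mat_mult[where m = n] index_exchange_mat_mult[where m = n])
      (auto simp: sigma_mat_def exchange_mat_def)
qed (auto simp: exchange_mat_def sigma_mat_def)

lemma transpose_Q_mat:
  "transpose_mat (Q_mat N)
    = four_block_mat (exchange_mat N) (0\<^sub>m N 0) (1\<^sub>m N) (0\<^sub>m N 0 :: 'a::semiring_1 mat)"
  unfolding Q_mat_def
  by (subst transpose_four_block_mat[where ?nr1.0 = N and ?nc1.0 = N and ?nr2.0 = 0 and ?nc2.0 = N])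
    (auto simp: transpose_exchange_mat)

lemma Q_mat_mult_transpose:
  "Q_mat N * transpose_mat (Q_mat N) = (2 \<cdot>\<^sub>m 1\<^sub>m N :: 'a::comm_ring_1 mat)"
  unfolding transpose_Q_mat unfolding Q_mat_def
  by (subst mult_four_block_mat[where ?nr1.0 = N and ?n1.0 = N and ?nr2.0 = 0 and ?n2.0 = N
        and ?nc1.0 = N and ?nc2.0 = 0])
    (auto simp: exchange_mat_mult_self intro!: eq_matI)

lemma transpose_mult_Q_mat:
  "transpose_mat (Q_mat N) * Q_mat N
    = (1\<^sub>m (2 * N) + exchange_mat (2 * N) :: 'a::comm_ring_1 mat)"
  unfolding transpose_Q_mat unfolding Q_mat_def one_plus_exchange_mat_double
  by (subst mult_four_block_mat[where ?nr1.0 = N and ?n1.0 = N and ?nr2.0 = N and ?n2.0 = 0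
        and ?nc1.0 = N and ?nc2.0 = N])
    (auto simp: exchange_mat_mult_self
      right_mult_one_mat[where nr = N] left_mult_one_mat[where nc = N])

text \<open>Swapping the two blocks of \<open>Q_mat\<close> and multiplying each by the small
  exchange matrix turns (J I) into (I J) J = (J I), as J is an involution.\<close>

lemma Q_mat_mult_exchange:
  "Q_mat N * exchange_mat (2 * N) = (Q_mat N :: 'a::comm_ring_1 mat)"
  unfolding Q_mat_def exchange_mat_double
  by (subst mult_four_block_mat[where ?nr1.0 = N and ?n1.0 = N and ?nr2.0 = 0 and ?n2.0 = N
        and ?nc1.0 = N and ?nc2.0 = N])
    (auto simp: exchange_mat_mult_self left_mult_one_mat[where nc = N]
      right_mult_zero_mat[where n = N and nr = N] left_mult_zero_mat[where n = N])

text \<open>\<open>pow_mat\<close> adds new factors on the right, whereas the recurrence splits them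
  off on the left.\<close>

lemma pow_mat_Suc_left:
  assumes "A \<in> carrier_mat n n"
  shows "A ^\<^sub>m Suc k = A * A ^\<^sub>m k"
proof (induction k)
  case (Suc k)
  have "A ^\<^sub>m Suc (Suc k) = A * A ^\<^sub>m k * A"
    using Suc by simp
  also have "\<dots> = A * A ^\<^sub>m Suc k"
    using assoc_mult_mat[OF assms pow_carrier_mat[OF assms] assms] by simp
  finally show ?case .
qed (use assms in auto)

text \<open>Treats both finite families at once: \<open>\<epsilon> = 1\<close> gives
  \<open>alpha_seq\<close> and \<open>\<epsilon> = -1\<close> gives \<open>beta_seq\<close>.\<close>

lemma compressed_sigma_recurrence:
  fixes \<epsilon> :: "'a::comm_ring_1" and N :: nat
  assumes eps: "\<epsilon> * \<epsilon> = 1"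
  defines "D \<equiv> \<lambda>k. Q_mat N * (sigma_mat (2 * N) \<epsilon> ^\<^sub>m k) * transpose_mat (Q_mat N)"
  shows "D (Suc (Suc k)) = D 1 * D (Suc k) - D k"
proof -
  define n where "n = 2 * N"
  define Q :: "'a mat" where "Q = Q_mat N"
  define T where "T = transpose_mat Q"
  define S where "S = sigma_mat n \<epsilon>"
  define P where "P = S ^\<^sub>m k"
  define J :: "'a mat" where "J = exchange_mat n"
  have Q: "Q \<in> carrier_mat N n" and T: "T \<in> carrier_mat n N"
    and S: "S \<in> carrier_mat n n" and J: "J \<in> carrier_mat n n"
    by (simp_all add: Q_def T_def S_def J_def n_def)
  have P: "P \<in> carrier_mat n n"
    unfolding P_def using S by (rule pow_carrier_mat)
  have SP: "S * P \<in> carrier_mat n n" and SSP: "S * (S * P) \<in> carrier_mat n n"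
    and JS: "J * S \<in> carrier_mat n n" and ST: "S * T \<in> carrier_mat n N"
    and PT: "P * T \<in> carrier_mat n N" and JPT: "J * (P * T) \<in> carrier_mat n N"
    and SPT: "S * P * T \<in> carrier_mat n N" and SSPT: "S * (S * P * T) \<in> carrier_mat n N"
    and QSPT: "Q * (S * P * T) \<in> carrier_mat N N"
    using P Q S T J by simp_all
  have D0: "D k = Q * P * T"
    by (simp add: D_def P_def S_def Q_def T_def n_def)
  have D1: "D (Suc 0) = Q * S * T"
    using S by (simp add: D_def S_def Q_def T_def n_def)
  have DS: "D (Suc k) = Q * (S * P) * T"
    using pow_mat_Suc_left[OF S] by (simp del: pow_mat.simps add: D_def P_def S_def Q_def T_def n_def)
  have DSS: "D (Suc (Suc k)) = Q * (S * (S * P)) * T"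
    using pow_mat_Suc_left[OF S] by (simp del: pow_mat.simps add: D_def P_def S_def Q_def T_def n_def)
  \<comment> \<open>The exchange matrix left over from \<open>T * Q\<close> is absorbed by
    \<open>Q\<close>.\<close>
  have D0_alt: "Q * (J * (P * T)) = D k"
    using assoc_mult_mat[OF Q J PT] assoc_mult_mat[OF Q P T] Q_mat_mult_exchange[of N, where 'a = 'a]
    by (simp add: D0 Q_def J_def n_def)
  \<comment> \<open>The two shifts around \<open>J\<close> cancel; this is what lowers the exponent
    by two.\<close>
  have SJSPT: "S * (J * (S * P * T)) = J * (P * T)"
  proof -
    have "S * (J * (S * P * T)) = S * (J * S) * (P * T)"
      by (simp add: assoc_mult_mat[OF S P T] assoc_mult_mat[OF J S PT] assoc_mult_mat[OF S JS PT])
    then show ?thesis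
      using sigma_exchange_sigma[OF eps] by (simp add: S_def J_def)
  qed
  \<comment> \<open>Only selected instances of associativity are applied, so that
    \<open>S * P * T\<close> stays one block next to \<open>T * Q\<close>.\<close>
  have "D (Suc 0) * D (Suc k) = Q * (S * (T * Q * (S * P * T)))"
    by (simp del: assoc_mult_mat add: D1 DS assoc_mult_mat[OF Q SP T] assoc_mult_mat[OF Q S T]
        assoc_mult_mat[OF Q ST QSPT] assoc_mult_mat[OF S T QSPT] assoc_mult_mat[OF T Q SPT])
  also have "T * Q = 1\<^sub>m n + J"
    using transpose_mult_Q_mat[of N, where 'a = 'a] by (simp add: T_def Q_def J_def n_def)
  also have "(1\<^sub>m n + J) * (S * P * T) = S * P * T + J * (S * P * T)"
    using add_mult_distrib_mat[OF one_carrier_mat J SPT] left_mult_one_mat[OF SPT]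
    by (simp del: assoc_mult_mat)
  also have "S * \<dots> = S * (S * P * T) + J * (P * T)"
    using mult_add_distrib_mat[OF S SPT mult_carrier_mat[OF J SPT]]
    by (simp del: assoc_mult_mat add: SJSPT)
  also have "Q * \<dots> = D (Suc (Suc k)) + D k"
    using mult_add_distrib_mat[OF Q SSPT JPT]
    by (simp del: assoc_mult_mat add: DSS D0_alt assoc_mult_mat[OF Q SSP T] assoc_mult_mat[OF S SP T])
  finally have sum: "D (Suc 0) * D (Suc k) = D (Suc (Suc k)) + D k" .
  \<comment> \<open>Moving \<open>D k\<close> to the other side is done entrywise, which requires
    the dimensions of all terms.\<close>
  have "D m \<in> carrier_mat N N" for m
    unfolding D_def by (intro mult_carrier_mat[where n = "2 * N"] pow_carrier_mat) auto
  then have "dim_row (D m) = N" "dim_col (D m) = N" for m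
    by blast+
  then show ?thesis
    using sum by (auto intro!: eq_matI)
qed

lemma inf_times_gamma:
  "inf_times gamma A i j = (A (i + 1) j + A (i - 1) j :: 'a::comm_ring_1)"
  \<comment> \<open>Truncated subtraction performs the reflection: row \<open>0 - 1\<close> is row 0.\<close>
proof -
  have "inf_times gamma A i j = (\<Sum>l\<in>{i + 1, i - 1}. gamma i l * A l j)"
    unfolding inf_times_def
    by (rule Sum_any.expand_superset)
      (auto simp: gamma_def gamma_seq_def split: if_splits)
  \<comment> \<open>The two indices differ even for \<open>i = 0\<close>, where they are 1 and 0, so
    there are exactly two summands.\<close>
  also have "\<dots> = A (i + 1) j + A (i - 1) j"
    by (cases i) (simp_all add: gamma_def gamma_seq_def)
  finally show ?thesis .
qed

text \<open>The conditions overlap only for \<open>k = 0\<close>, where the first two produce the diagonal entry 2.\<close>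

lemma gamma_seq_eq:
  "gamma_seq k i j = (if i = j + k then 1 else 0) + (if j = i + k then 1 else 0)
    + (if i + j + 1 = k then 1 else 0 :: 'a::comm_ring_1)"
  by (auto simp: gamma_seq_def inf_smult_def inf_one_def)

text \<open>For \<open>i > 0\<close>, moving to the rows \<open>i + 1\<close> and
  \<open>i - 1\<close> changes the parameter \<open>Suc k\<close> in each of the three indicators of
  \<open>gamma_seq_eq\<close> by one, once up and once down. The terms sum to
  \<open>gamma_seq (Suc (Suc k))\<close> plus \<open>gamma_seq k\<close>.\<close>

lemma gamma_seq_recurrence:
  "gamma_seq (Suc (Suc k))
    = inf_times gamma (gamma_seq (Suc k)) - (gamma_seq k :: 'a::comm_ring_1 inf_mat)"
proof (intro ext)
  fix i j
  show "gamma_seq (Suc (Suc k)) i j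
      = (inf_times gamma (gamma_seq (Suc k)) - (gamma_seq k :: 'a inf_mat)) i j"
    \<comment> \<open>In row 0 the reflected row supplies the same two terms with roles exchanged:
      its antidiagonal indicator gives \<open>j = k\<close>, its diagonal one gives
      \<open>j = k + 1\<close>.\<close>
    by (cases i) (auto simp: inf_times_gamma gamma_seq_eq)
qed

theorem theorem5p1:
  fixes N :: nat
  assumes "N \<ge> 1"
  shows "((alpha_seq N 1 :: 'a::comm_ring_1 mat) = alpha N
          \<and> (alpha_seq N 0 :: 'a mat) = 2 \<cdot>\<^sub>m 1\<^sub>m N
          \<and> (\<forall>k\<ge>2. (alpha_seq N k :: 'a mat) = alpha N * alpha_seq N (k - 1) - alpha_seq N (k - 2)))
       \<and> ((beta_seq N 1 :: 'a mat) = beta N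
          \<and> (beta_seq N 0 :: 'a mat) = 2 \<cdot>\<^sub>m 1\<^sub>m N
          \<and> (\<forall>k\<ge>2. (beta_seq N k :: 'a mat) = beta N * beta_seq N (k - 1) - beta_seq N (k - 2)))
       \<and> ((gamma_seq 1 :: 'a inf_mat) = gamma
          \<and> (gamma_seq 0 :: 'a inf_mat) = inf_smult 2 inf_one
          \<and> (\<forall>k\<ge>2. (gamma_seq k :: 'a inf_mat)
                = inf_times gamma (gamma_seq (k - 1)) - gamma_seq (k - 2)))"
proof -
  \<comment> \<open>Polymorphic in the values of \<open>f\<close>, so that it serves finite and
    infinite matrices alike.\<close>
  have shift: "f k = g (f (k - 1)) (f (k - 2))"
    if "k \<ge> 2" "\<And>m. f (Suc (Suc m)) = g (f (Suc m)) (f m)"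
    for f :: "nat \<Rightarrow> 'b" and g and k :: nat
    using that(1) that(2)[of "k - 2"] by (simp add: numeral_2_eq_2 Suc_diff_Suc)
  have alpha: "alpha_seq N (Suc (Suc k)) = alpha N * alpha_seq N (Suc k) - (alpha_seq N k :: 'a mat)"
    for k
    unfolding alpha_def alpha_seq_def by (rule compressed_sigma_recurrence) simp
  have beta: "beta_seq N (Suc (Suc k)) = beta N * beta_seq N (Suc k) - (beta_seq N k :: 'a mat)"
    for k
    unfolding beta_def beta_seq_def by (rule compressed_sigma_recurrence) simp
  have zero: "Q_mat N * (sigma_mat (2 * N) \<epsilon> ^\<^sub>m 0) * transpose_mat (Q_mat N) = 2 \<cdot>\<^sub>m 1\<^sub>m N"
    for \<epsilon> :: 'a
  proof -
    \<comment> \<open>The zeroth power is the identity of order \<open>dim_row\<close>, which has to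
      be known before it cancels against \<open>Q_mat N\<close>.\<close>
    have "dim_row (sigma_mat (2 * N) \<epsilon>) = 2 * N"
      using sigma_mat_carrier by blast
    then show ?thesis
      by (simp add: right_mult_one_mat[OF Q_mat_carrier] Q_mat_mult_transpose)
  qed
  show ?thesis
    using shift[of _ "alpha_seq N", OF _ alpha] shift[of _ "beta_seq N", OF _ beta]
      shift[of _ gamma_seq, OF _ gamma_seq_recurrence]
      zero[of 1] zero[of "- 1"]
    by (auto simp: fun_diff_def alpha_def beta_def gamma_def alpha_seq_def[of _ 0] beta_seq_def[of _ 0]
        gamma_seq_def[of 0])
qed

end
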